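(* Let $S$ be a spider with one leg of arbitrary length and all other legs of length at most two. Then $S$ has a graceful labeling in which its center is labeled $0$.
   Context: For integers $p,q$, $[p,q]=\{i\in\mathbb{Z}: p\le i\le q\}$. A graceful labeling of a graph $G$ is an injective function $f:V(G)\to[0,|E(G)|]$ such that $\{|f(x)-f(y)| : xy\in E(G)\}=[1,|E(G)|]$. A spider is a tree with at most one vertex of degree greater than two; when such a vertex exists it is the center, and each path in the spider joining the center to a leaf is called a leg. A leg's length is its number of edges. *)

theory Defs
  imports Main
begin

text \<open>
  A graph is given by its vertex set \<open>V\<close> and its set \<open>E\<close> of edges, an edge \<open>xy\<close> being the
  two-element set \<open>{x, y}\<close>.
\<close>

definition simple_graph :: "'a set \<Rightarrow> 'a set set \<Rightarrow> bool" where
  "simple_graph V E \<longleftrightarrow> finite V \<and> (\<forall>e\<in>E. \<exists>x y. x \<in> V \<and> y \<in> V \<and> x \<noteq> y \<and> e = {x, y})"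

definition degree :: "'a set set \<Rightarrow> 'a \<Rightarrow> nat" where
  "degree E v = card {e \<in> E. v \<in> e}"

definition graph_path :: "'a set \<Rightarrow> 'a set set \<Rightarrow> 'a list \<Rightarrow> bool" where
  "graph_path V E p \<longleftrightarrow> p \<noteq> [] \<and> distinct p \<and> set p \<subseteq> V \<and>
     (\<forall>i. Suc i < length p \<longrightarrow> {p ! i, p ! Suc i} \<in> E)"

definition path_length :: "'a list \<Rightarrow> nat" where
  "path_length p = length p - 1"

definition graph_cycle :: "'a set \<Rightarrow> 'a set set \<Rightarrow> 'a list \<Rightarrow> bool" where
  "graph_cycle V E p \<longleftrightarrow> graph_path V E p \<and> length p \<ge> 3 \<and> {last p, hd p} \<in> E"

definition connected_graph :: "'a set \<Rightarrow> 'a set set \<Rightarrow> bool" where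
  "connected_graph V E \<longleftrightarrow> V \<noteq> {} \<and>
     (\<forall>u\<in>V. \<forall>v\<in>V. \<exists>p. graph_path V E p \<and> hd p = u \<and> last p = v)"

definition tree_graph :: "'a set \<Rightarrow> 'a set set \<Rightarrow> bool" where
  "tree_graph V E \<longleftrightarrow> simple_graph V E \<and> connected_graph V E \<and> \<not> (\<exists>p. graph_cycle V E p)"

definition spider :: "'a set \<Rightarrow> 'a set set \<Rightarrow> bool" where
  "spider V E \<longleftrightarrow> tree_graph V E \<and>
     (\<forall>u\<in>V. \<forall>v\<in>V. degree E u > 2 \<and> degree E v > 2 \<longrightarrow> u = v)"

text \<open>
  If a spider has a vertex of degree greater than two, that vertex is its only center.  A spider
  without such a vertex is a path, and any of its vertices may be taken as the center.
\<close>

definition spider_center :: "'a set \<Rightarrow> 'a set set \<Rightarrow> 'a \<Rightarrow> bool" where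
  "spider_center V E c \<longleftrightarrow> c \<in> V \<and>
     ((\<exists>v\<in>V. degree E v > 2) \<longrightarrow> degree E c > 2)"

text \<open>
  The condition \<open>last p \<noteq> c\<close> only matters when the center is an end of a path: it keeps the
  one-vertex path \<open>[c]\<close> from being counted as a leg.
\<close>

definition spider_legs :: "'a set \<Rightarrow> 'a set set \<Rightarrow> 'a \<Rightarrow> 'a list set" where
  "spider_legs V E c =
     {p. graph_path V E p \<and> hd p = c \<and> last p \<noteq> c \<and> degree E (last p) = 1}"

definition graceful_labeling :: "'a set \<Rightarrow> 'a set set \<Rightarrow> ('a \<Rightarrow> int) \<Rightarrow> bool" where
  "graceful_labeling V E f \<longleftrightarrow> inj_on f V \<and> f ` V \<subseteq> {0..int (card E)} \<and>
     {\<bar>f x - f y\<bar> |x y. {x, y} \<in> E} = {1..int (card E)}"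

end

theory Submission
  imports Defs
begin

text \<open>
  Legs of length one cost nothing: they receive the labels above all others.  Let the rest of the
  spider consist of \<open>m\<close> legs \<open>c, a, b\<close> and the long leg \<open>x\<^sub>0 = c, x\<^sub>1, \<dots>, x\<^sub>l\<close>, and put \<open>n = l + 2m\<close>.
  The edges \<open>ab\<close> together with every second edge of the long leg, counted from its end, form a
  matching that misses at most the vertex \<open>c\<close>.  Contracting it leaves a spider with one long leg
  and \<open>m\<close> legs of length one, which has an obvious graceful labeling \<open>g\<close> with center \<open>0\<close> (zigzag on
  the leg, largest labels on the leaves).  Give the two ends of a contracted edge with label \<open>g\<close>
  the labels \<open>2g\<close> and \<open>M - 2g\<close>, where \<open>M\<close> is the odd one of \<open>n\<close> and \<open>n + 1\<close>, in such a way that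
  every remaining edge joins labels of equal parity.  The remaining edges then realize all even
  differences, and the matching edges, with differences \<open>|M - 4g|\<close>, all odd ones.

  It suffices to check that all labels and all differences occur; injectivity follows by counting.
\<close>

section \<open>The labels on the long leg\<close>

text \<open>The first summand is the zigzag \<open>0, l, 1, l - 1, ...\<close> along the leg; the
  second adds \<open>2 * m\<close> to exactly those zigzag values that are odd. The test modulo 4
  reads off their parity: at odd \<open>t\<close> it also depends on the parity of
  \<open>l\<close>.\<close>

definition leg_label :: "nat \<Rightarrow> nat \<Rightarrow> nat \<Rightarrow> int" where
  "leg_label l m t =
     (if even t then int (t div 2) else int l - int (t div 2)) +
     (if t mod 4 = 0 \<or> odd t \<and> (t mod 4 = 1 \<longleftrightarrow> even l) then 0 else 2 * int m)"

lemma leg_label_simps: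
  "leg_label l m (4 * s) = 2 * int s"
  "leg_label l m (4 * s + 1) = int l - 2 * int s + (if even l then 0 else 2 * int m)"
  "leg_label l m (4 * s + 2) = 2 * int s + 1 + 2 * int m"
  "leg_label l m (4 * s + 3) = int l - 2 * int s - 1 + (if even l then 2 * int m else 0)"
  "leg_label l m (4 * s + 4) = 2 * int s + 2"
proof -
  have d: "(4 * s + 1) div 2 = 2 * s" "(4 * s + 2) div 2 = 2 * s + 1" "(4 * s + 3) div 2 = 2 * s + 1"
    "(4 * s + 4) div 2 = 2 * s + 2" "(4 * s + 1) mod 4 = 1" "(4 * s + 2) mod 4 = 2"
    "(4 * s + 3) mod 4 = 3" "(4 * s + 4) mod 4 = 0"
    by presburger+
  show "leg_label l m (4 * s) = 2 * int s"
    by (simp add: leg_label_def)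
  show "leg_label l m (4 * s + 1) = int l - 2 * int s + (if even l then 0 else 2 * int m)"
    "leg_label l m (4 * s + 2) = 2 * int s + 1 + 2 * int m"
    "leg_label l m (4 * s + 3) = int l - 2 * int s - 1 + (if even l then 2 * int m else 0)"
    "leg_label l m (4 * s + 4) = 2 * int s + 2"
    unfolding leg_label_def d by auto
qed

text \<open>Edge number \<open>t\<close> of the zigzag has difference \<open>l - t\<close>. If this
  is even, the ends have equal parity and are shifted together or not at all; if it is odd, exactly
  the odd end moves by \<open>2 * m\<close>.\<close>

lemma leg_label_diff:
  "\<bar>leg_label l m (4 * s) - leg_label l m (Suc (4 * s))\<bar>
     = \<bar>int l - 4 * int s + (if even l then 0 else 2 * int m)\<bar>"
  "\<bar>leg_label l m (4 * s + 1) - leg_label l m (Suc (4 * s + 1))\<bar>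
     = \<bar>int l - 4 * int s - 1 - (if even l then 2 * int m else 0)\<bar>"
  "\<bar>leg_label l m (4 * s + 2) - leg_label l m (Suc (4 * s + 2))\<bar>
     = \<bar>int l - 4 * int s - 2 - (if even l then 0 else 2 * int m)\<bar>"
  "\<bar>leg_label l m (4 * s + 3) - leg_label l m (Suc (4 * s + 3))\<bar>
     = \<bar>int l - 4 * int s - 3 + (if even l then 2 * int m else 0)\<bar>"
proof -
  have e: "Suc (4 * s) = 4 * s + 1" "Suc (4 * s + 1) = 4 * s + 2" "Suc (4 * s + 2) = 4 * s + 3"
    "Suc (4 * s + 3) = 4 * s + 4"
    by simp_all
  show "\<bar>leg_label l m (4 * s) - leg_label l m (Suc (4 * s))\<bar>
     = \<bar>int l - 4 * int s + (if even l then 0 else 2 * int m)\<bar>"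
  "\<bar>leg_label l m (4 * s + 1) - leg_label l m (Suc (4 * s + 1))\<bar>
     = \<bar>int l - 4 * int s - 1 - (if even l then 2 * int m else 0)\<bar>"
  "\<bar>leg_label l m (4 * s + 2) - leg_label l m (Suc (4 * s + 2))\<bar>
     = \<bar>int l - 4 * int s - 2 - (if even l then 0 else 2 * int m)\<bar>"
  "\<bar>leg_label l m (4 * s + 3) - leg_label l m (Suc (4 * s + 3))\<bar>
     = \<bar>int l - 4 * int s - 3 + (if even l then 2 * int m else 0)\<bar>"
    unfolding e leg_label_simps by (auto simp: abs_if)
qed

text \<open>The zigzag takes every value in \<open>0..l\<close>. Shifting its odd values vacates the
  odd numbers below \<open>2 * m\<close>, which go to the outer ends of the legs of length two; the
  middle vertices of these legs get the even numbers above \<open>l\<close>.\<close>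

lemma labels_surjective:
  fixes l m :: nat and v :: int
  assumes "0 \<le> v" "v \<le> int (l + 2 * m)"
  shows "(\<exists>t\<le>l. v = leg_label l m t) \<or>
    (\<exists>i<m. v = 2 * int ((l + 2 * m) div 2 - i) \<or> v = 2 * int i + 1)"
proof (cases "even v")
  case True
  define g where "g = nat (v div 2)"
  have v: "v = 2 * int g" using True assms by (simp add: g_def)
  have le: "2 * g \<le> l + 2 * m" using assms v by linarith
  \<comment> \<open>The zigzag value \<open>u\<close> stands at position \<open>2 * u\<close> if
    this is at most \<open>l\<close>, and otherwise at position \<open>2 * (l - u) + 1\<close>. Here
    \<open>u = 2 * g\<close>; the residue of the second position modulo 4 depends on the parity of
    \<open>l\<close>.\<close>
  consider "2 * g > l" | "4 * g \<le> l" | "2 * g \<le> l" "4 * g > l" by linarith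
  then show ?thesis
  proof cases
    case 1
    define i where "i = (l + 2 * m) div 2 - g"
    have "i < m" "g = (l + 2 * m) div 2 - i" using 1 le by (auto simp: i_def)
    then show ?thesis using v by metis
  next
    case 2
    then show ?thesis using v leg_label_simps(1)[of l m g] by metis
  next
    case 3
    show ?thesis
    proof (cases "even l")
      case True
      then obtain p where p: "l = 2 * p" by blast
      have "v = leg_label l m (4 * (p - g) + 1)"
        unfolding leg_label_simps using p v 3 by auto
      moreover have "4 * (p - g) + 1 \<le> l" using p 3 by linarith
      ultimately show ?thesis by blast
    next
      case False
      then obtain p where p: "l = 2 * p + 1" by (metis oddE)
      have "v = leg_label l m (4 * (p - g) + 3)"
        unfolding leg_label_simps using p v 3 by auto
      moreover have "4 * (p - g) + 3 \<le> l" using p 3 by presburger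
      ultimately show ?thesis by blast
    qed
  qed
next
  case False
  define g where "g = nat (v div 2)"
  have v: "v = 2 * int g + 1" using False assms by (simp add: g_def)
  have le: "2 * g + 1 \<le> l + 2 * m" using assms v by linarith
  \<comment> \<open>For \<open>g = m + s\<close> the label is the zigzag value
    \<open>2 * s + 1\<close> after the shift, and its position is found as for even labels.\<close>
  consider "g < m" | s where "g = m + s" "4 * s + 2 \<le> l" | s where "g = m + s" "4 * s + 2 > l"
    by (metis le_add_diff_inverse not_le)
  then show ?thesis
  proof cases
    case 1
    then show ?thesis using v by blast
  next
    case (2 s)
    then have "v = leg_label l m (4 * s + 2)"
      unfolding leg_label_simps using v by auto
    then show ?thesis using 2 by blast
  next
    case (3 s)
    show ?thesis
    proof (cases "even l")
      case True
      then obtain p where p: "l = 2 * p" by blast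
      have s: "s + 1 \<le> p" using le 3 p by presburger
      have "v = leg_label l m (4 * (p - s - 1) + 3)"
        unfolding leg_label_simps using p v s 3 by auto
      moreover have "4 * (p - s - 1) + 3 \<le> l" using p 3 s by presburger
      ultimately show ?thesis by blast
    next
      case False
      then obtain p where p: "l = 2 * p + 1" by (metis oddE)
      have s: "s \<le> p" using le 3 p by presburger
      have "v = leg_label l m (4 * (p - s) + 1)"
        unfolding leg_label_simps using p v s 3 by auto
      moreover have "4 * (p - s) + 1 \<le> l" using p 3 s by presburger
      ultimately show ?thesis by blast
    qed
  qed
qed

lemma differences_surjective:
  fixes l m :: nat and d :: int
  assumes "1 \<le> d" "d \<le> int (l + 2 * m)"
  shows "(\<exists>t<l. d = \<bar>leg_label l m t - leg_label l m (Suc t)\<bar>) \<or>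
    (\<exists>i<m. d = 2 * int ((l + 2 * m) div 2 - i) \<or>
            d = \<bar>2 * int ((l + 2 * m) div 2 - i) - (2 * int i + 1)\<bar>)"
proof (cases "even d")
  case True
  define g where "g = nat (d div 2)"
  have d: "d = 2 * int g" using True assms by (simp add: g_def)
  have le: "2 * g \<le> l + 2 * m" "g > 0" using assms d by linarith+
  show ?thesis
  proof (cases "2 * g \<le> l")
    case False
    define i where "i = (l + 2 * m) div 2 - g"
    have "i < m" "g = (l + 2 * m) div 2 - i" using False le by (auto simp: i_def)
    then show ?thesis using d by metis
  next
    case True
    \<comment> \<open>The edge of zigzag difference \<open>2 * g\<close>; even differences survive
      the shift.\<close>
    define t where "t = l - 2 * g"
    have t: "l = t + 2 * g" "t < l" using True le by (auto simp: t_def)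
    have "\<exists>s. t = 4 * s \<or> t = 4 * s + 1 \<or> t = 4 * s + 2 \<or> t = 4 * s + 3" by presburger
    then obtain s where "t = 4 * s \<or> t = 4 * s + 1 \<or> t = 4 * s + 2 \<or> t = 4 * s + 3" by blast
    then have "\<bar>leg_label l m t - leg_label l m (Suc t)\<bar> = d"
      using t d leg_label_diff[of l m s] by (elim disjE) auto
    then show ?thesis using t by blast
  qed
next
  case False
  \<comment> \<open>\<open>2 * K + 1\<close> is the odd number \<open>M\<close> of the overview, and
    the leg contributes the labels \<open>2 * g\<close> with \<open>g \<le> p\<close>.\<close>
  define K where "K = (l + 2 * m) div 2"
  define p where "p = l div 2"
  define e where "e = nat (d div 2)"
  have d: "d = 2 * int e + 1" using False assms by (simp add: e_def)
  have K: "K = m + p" by (simp add: K_def p_def)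
  have "e \<le> K" using assms d unfolding K_def by linarith
  \<comment> \<open>Solves \<open>2 * e + 1 = \<bar>2 * K + 1 - 4 * g\<bar>\<close>, the difference
    on the matching edge with even label \<open>2 * g\<close>. The parity of \<open>K - e\<close>
    decides the sign inside the absolute value.\<close>
  obtain g where g: "g \<le> K" "2 * e + 4 * g = 2 * K \<or> 4 * g = 2 * K + 2 * e + 2"
  proof (cases "even (K - e)")
    case True
    then have "2 * e + 4 * ((K - e) div 2) = 2 * K" using \<open>e \<le> K\<close> by presburger
    then show ?thesis using that[of "(K - e) div 2"] by simp
  next
    case False
    then have "4 * ((K + e + 1) div 2) = 2 * K + 2 * e + 2" "(K + e + 1) div 2 \<le> K"
      using \<open>e \<le> K\<close> by presburger+
    then show ?thesis using that[of "(K + e + 1) div 2"] by simp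
  qed
  then have dg: "d = \<bar>2 * int K + 1 - 4 * int g\<bar>" using d by linarith
  show ?thesis
  \<comment> \<open>For \<open>g > p\<close> the label \<open>2 * g\<close> belongs to leg number
    \<open>K - g\<close> of length two; otherwise the matching edge lies on the long leg.\<close>
  proof (cases "g \<le> p")
    case False
    then have "K - g < m" "g = K - (K - g)" using g K by auto
    moreover have "d = \<bar>2 * int (K - (K - g)) - (2 * int (K - g) + 1)\<bar>" using dg g by auto
    ultimately show ?thesis unfolding K_def by blast
  next
    case gp: True
    show ?thesis
    proof (cases "even l")
      case True
      then have l: "l = 2 * p" by (simp add: p_def)
      \<comment> \<open>For even \<open>l\<close> the center is unmatched: \<open>g = 0\<close>
        would give the difference \<open>l + 2 * m + 1\<close>, which is too large.\<close>
      have "g > 0" using dg assms(2) K l by (cases "g = 0") auto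
      \<comment> \<open>For even \<open>l\<close> the matching consists of the edges at odd
        \<open>t\<close>. The label \<open>2 * g\<close> is at position \<open>4 * g\<close>, the
        far end of edge \<open>4 * g - 1\<close>, or at position \<open>4 * (p - g) + 1\<close>, the
        near end of its edge.\<close>
      show ?thesis
      proof (cases "2 * g \<le> p")
        case True
        obtain s where s: "g = s + 1" using \<open>g > 0\<close> by (metis Suc_eq_plus1 Suc_pred)
        have "d = \<bar>leg_label l m (4 * s + 3) - leg_label l m (Suc (4 * s + 3))\<bar>"
          unfolding leg_label_diff using dg s l K by auto
        moreover have "4 * s + 3 < l" using True s l by linarith
        ultimately show ?thesis by blast
      next
        case False
        have "d = \<bar>leg_label l m (4 * (p - g) + 1) - leg_label l m (Suc (4 * (p - g) + 1))\<bar>"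
          unfolding leg_label_diff using dg l K gp by auto
        moreover have "4 * (p - g) + 1 < l" using False l gp by linarith
        ultimately show ?thesis by blast
      qed
    next
      case False
      then have l: "l = 2 * p + 1" by (simp add: p_def)
      \<comment> \<open>For odd \<open>l\<close> the matching edges are those at even
        \<open>t\<close>: position \<open>4 * g\<close> is the near end of its edge, position
        \<open>4 * (p - g) + 3\<close> the far end.\<close>
      show ?thesis
      proof (cases "2 * g \<le> p")
        case True
        have "d = \<bar>leg_label l m (4 * g) - leg_label l m (Suc (4 * g))\<bar>"
          unfolding leg_label_diff using dg l K by auto
        moreover have "4 * g < l" using True l by linarith
        ultimately show ?thesis by blast
      next
        case False
        have "d = \<bar>leg_label l m (4 * (p - g) + 2) - leg_label l m (Suc (4 * (p - g) + 2))\<bar>"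
          unfolding leg_label_diff using dg l K gp by auto
        moreover have "4 * (p - g) + 2 < l" using False l gp by linarith
        ultimately show ?thesis by blast
      qed
    qed
  qed
qed

section \<open>Paths in acyclic graphs\<close>

lemma simple_graph_finite_edges:
  assumes "simple_graph V E"
  shows "finite E"
proof (rule finite_subset)
  show "E \<subseteq> Pow V" using assms by (auto simp: simple_graph_def)
  show "finite (Pow V)" using assms by (simp add: simple_graph_def)
qed

lemma simple_graph_edgeD:
  assumes "simple_graph V E" "{u, v} \<in> E"
  shows "u \<in> V" "v \<in> V" "u \<noteq> v"
proof -
  obtain x y where "x \<in> V" "y \<in> V" "x \<noteq> y" "{u, v} = {x, y}"
    using assms unfolding simple_graph_def by blast
  then show "u \<in> V" "v \<in> V" "u \<noteq> v" by (auto simp: doubleton_eq_iff)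
qed

lemma card_neighbours_le_degree:
  assumes "finite E" "\<And>x. x \<in> S \<Longrightarrow> {v, x} \<in> E"
  shows "card S \<le> degree E v"
proof -
  have "inj_on (\<lambda>x. {v, x}) S" by (auto simp: inj_on_def doubleton_eq_iff)
  then have "card S = card ((\<lambda>x. {v, x}) ` S)" by (simp add: card_image)
  also have "\<dots> \<le> degree E v"
    unfolding degree_def using assms by (intro card_mono) auto
  finally show ?thesis .
qed

lemma graph_path_edge:
  assumes "graph_path V E p" "Suc i < length p"
  shows "{p ! i, p ! Suc i} \<in> E"
  using assms by (simp add: graph_path_def)

lemma graph_path_append1:
  assumes "graph_path V E p" "w \<in> V" "w \<notin> set p" "{last p, w} \<in> E"
  shows "graph_path V E (p @ [w])"
proof -
  have "{(p @ [w]) ! i, (p @ [w]) ! Suc i} \<in> E" if "Suc i < length (p @ [w])" for i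
  proof (cases "Suc i < length p")
    case True
    then show ?thesis using assms(1) by (simp add: graph_path_def nth_append)
  next
    case False
    then have "i = length p - 1" "p \<noteq> []" using that assms(1) by (auto simp: graph_path_def)
    then show ?thesis using assms(4) by (simp add: nth_append last_conv_nth)
  qed
  then show ?thesis using assms by (simp add: graph_path_def)
qed

lemma graph_path_take:
  assumes "graph_path V E p" "k > 0"
  shows "graph_path V E (take k p)"
  using assms by (auto simp: graph_path_def dest: in_set_takeD)

lemma graph_path_drop:
  assumes "graph_path V E p" "k < length p"
  shows "graph_path V E (drop k p)"
  using assms by (auto simp: graph_path_def dest: in_set_dropD)

text \<open>If \<open>w\<close> came earlier on the path, the part of the path from \<open>w\<close>
  on would have at least three vertices and be closed to a cycle by the edge back to
  \<open>w\<close>.\<close>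

lemma chord_is_last_edge:
  assumes "simple_graph V E" "\<not> (\<exists>p. graph_cycle V E p)" "graph_path V E p"
    and "w \<in> set p" "{last p, w} \<in> E"
  shows "length p \<ge> 2 \<and> w = p ! (length p - 2)"
proof (rule ccontr)
  assume not2: "\<not> ?thesis"
  obtain k where k: "k < length p" "p ! k = w" using assms(4) by (metis in_set_conv_nth)
  have "w \<noteq> last p" using simple_graph_edgeD(3)[OF assms(1,5)] by simp
  then have "k \<noteq> length p - 1" using k last_conv_nth[of p] by fastforce
  moreover have "k \<noteq> length p - 2" using not2 k calculation by (cases "length p \<ge> 2") auto
  ultimately have "length (drop k p) \<ge> 3" using k by simp
  moreover have "{last (drop k p), hd (drop k p)} \<in> E"
    using k assms(5) by (simp add: hd_drop_conv_nth)
  ultimately show False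
    using assms(2) graph_path_drop[OF assms(3) k(1)] unfolding graph_cycle_def by blast
qed

text \<open>An end that is not a leaf has an edge besides the one by which the path arrives. Its
  other end is off the path, since a chord could only be the last edge; so the path grows, which
  finiteness of \<open>V\<close> bounds.\<close>

lemma graph_path_extends_to_leaf:
  assumes "simple_graph V E" "\<not> (\<exists>p. graph_cycle V E p)"
    and "graph_path V E p" "length p \<ge> 2"
  shows "\<exists>q. graph_path V E (p @ q) \<and> degree E (last (p @ q)) = 1"
  using assms(3,4)
proof (induction "card V - length p" arbitrary: p rule: less_induct)
  case less
  have fin: "finite E" "finite V"
    using simple_graph_finite_edges assms(1) by (auto simp: simple_graph_def)
  show ?case
  proof (cases "degree E (last p) = 1")
    case True
    then show ?thesis using less.prems by (intro exI[of _ "[]"]) simp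
  next
    case False
    let ?u = "p ! (length p - 2)"
    let ?I = "{e \<in> E. last p \<in> e}"
    have "{?u, p ! Suc (length p - 2)} \<in> E"
      using less.prems by (intro graph_path_edge) auto
    moreover have "p ! Suc (length p - 2) = last p"
      using less.prems(2) by (subst last_conv_nth) (auto simp: Suc_diff_Suc numeral_2_eq_2)
    ultimately have "{last p, ?u} \<in> ?I" by (simp add: insert_commute)
    \<comment> \<open>The set of edges at the end is nonempty; contained in this singleton it would
      have one element, against the degree not being 1.\<close>
    then have "?I = {{last p, ?u}}" if "?I \<subseteq> {{last p, ?u}}" using that by blast
    then have "\<not> ?I \<subseteq> {{last p, ?u}}" using False unfolding degree_def by fastforce
    then obtain e where e: "e \<in> E" "last p \<in> e" "e \<noteq> {last p, ?u}" by blast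
    obtain x y where "x \<in> V" "y \<in> V" "x \<noteq> y" "e = {x, y}"
      using assms(1) e(1) unfolding simple_graph_def by blast
    then obtain w where w: "e = {last p, w}" "w \<in> V" using e(2) by (metis insertE insert_commute singletonD)
    have "{last p, w} \<in> E" "w \<noteq> ?u" using e w by auto
    then have "w \<notin> set p"
      using chord_is_last_edge[OF assms(1,2) less.prems(1)] by metis
    then have path: "graph_path V E (p @ [w])"
      using graph_path_append1[OF less.prems(1) w(2)] e w by simp
    then have "length (p @ [w]) \<le> card V"
      using card_mono[OF fin(2), of "set (p @ [w])"] distinct_card[of "p @ [w]"]
      by (simp add: graph_path_def)
    then have "card V - length (p @ [w]) < card V - length p" by simp
    from less.hyps[OF this path] obtain q
      where "graph_path V E ((p @ [w]) @ q) \<and> degree E (last ((p @ [w]) @ q)) = 1"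
      using less.prems(2) by auto
    then show ?thesis by (intro exI[of _ "w # q"]) simp
  qed
qed

section \<open>The shape of the spider\<close>

text \<open>\<open>degree_le_2\<close> treats both kinds of spider alike: a vertex of degree above
  two can only be \<open>c\<close>, whether or not one exists.\<close>

locale long_leg_spider =
  fixes V :: "'a set" and E :: "'a set set" and c :: 'a and L :: "'a list"
  assumes simple: "simple_graph V E"
    and acyclic: "\<not> (\<exists>p. graph_cycle V E p)"
    and connected: "connected_graph V E"
    and degree_le_2: "v \<in> V \<Longrightarrow> v \<noteq> c \<Longrightarrow> degree E v \<le> 2"
    and center_in: "c \<in> V"
    and long_leg: "L \<in> spider_legs V E c"
    and short_leg: "L' \<in> spider_legs V E c \<Longrightarrow> L' \<noteq> L \<Longrightarrow> path_length L' \<le> 2"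
begin

text \<open>The vertices \<open>a\<close> of the legs \<open>c, a, b\<close>, described by adjacency
  so that no leg has to be analysed first. \<open>toe a\<close> is the matching \<open>b\<close>,
  and \<open>stubs\<close> are the ends of the other legs of length one.\<close>

definition knees :: "'a set" where
  "knees = {a. {c, a} \<in> E \<and> a \<noteq> L ! 1 \<and> (\<exists>b. b \<noteq> c \<and> {a, b} \<in> E)}"

definition stubs :: "'a set" where
  "stubs = {a. {c, a} \<in> E \<and> a \<noteq> L ! 1} - knees"

definition toe :: "'a \<Rightarrow> 'a" where
  "toe a = (SOME b. b \<noteq> c \<and> {a, b} \<in> E)"

lemmas edgeD = simple_graph_edgeD[OF simple]

lemma finite_V: "finite V" and finite_E: "finite E"
  using simple simple_graph_finite_edges by (auto simp: simple_graph_def)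

lemma L_path: "graph_path V E L" and L_0: "L ! 0 = c" and L_length: "length L \<ge> 2"
  and L_last: "degree E (last L) = 1"
proof -
  show path: "graph_path V E L" and "degree E (last L) = 1"
    using long_leg by (simp_all add: spider_legs_def)
  have L: "L \<noteq> []" "hd L = c" "last L \<noteq> c"
    using long_leg by (auto simp: spider_legs_def graph_path_def)
  then show "L ! 0 = c" by (simp add: hd_conv_nth)
  show "length L \<ge> 2"
  proof (rule ccontr)
    assume "\<not> length L \<ge> 2"
    moreover have "length L \<noteq> 0" using L(1) by simp
    ultimately have "length L = 1" by linarith
    then show False using L by (auto simp: length_Suc_conv)
  qed
qed

lemma L_nonempty: "L \<noteq> []"
  using L_length by auto

lemma L_distinct: "distinct L" and L_subset: "set L \<subseteq> V"
  using L_path by (auto simp: graph_path_def)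

lemma stubs_or_knees_iff: "a \<in> stubs \<union> knees \<longleftrightarrow> {c, a} \<in> E \<and> a \<noteq> L ! 1"
  by (auto simp: stubs_def knees_def)

lemma toe: "a \<in> knees \<Longrightarrow> toe a \<noteq> c" "a \<in> knees \<Longrightarrow> {a, toe a} \<in> E"
proof -
  assume "a \<in> knees"
  then have "\<exists>b. b \<noteq> c \<and> {a, b} \<in> E" by (simp add: knees_def)
  then have "toe a \<noteq> c \<and> {a, toe a} \<in> E" unfolding toe_def by (rule someI_ex)
  then show "toe a \<noteq> c" "{a, toe a} \<in> E" by auto
qed

section \<open>Disjointness of the pieces of the spider\<close>

lemma no_cycle: "graph_cycle V E p \<Longrightarrow> False"
  using acyclic by blast

lemma stubs_or_knees_notin_L:
  assumes "a \<in> stubs \<union> knees"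
  shows "a \<notin> set L"
proof
  assume "a \<in> set L"
  then obtain j where j: "j < length L" "L ! j = a" by (metis in_set_conv_nth)
  have a: "{c, a} \<in> E" "a \<noteq> L ! 1" using assms stubs_or_knees_iff by auto
  moreover have "c \<noteq> a" by (rule edgeD(3)[OF a(1)])
  ultimately have "j \<noteq> 0" "j \<noteq> 1" using j L_0 by metis+
  moreover have last_take: "last (take (Suc j) L) = a" using j by (simp add: take_Suc_conv_app_nth)
  ultimately have "graph_cycle V E (take (Suc j) L)"
    using graph_path_take[OF L_path, of "Suc j"] last_take j a L_0 L_nonempty
    by (auto simp: graph_cycle_def hd_conv_nth insert_commute)
  then show False by (rule no_cycle)
qed

text \<open>Otherwise the long leg up to \<open>toe a\<close>, followed by \<open>a\<close>, closes
  to a cycle at \<open>c\<close>.\<close>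

lemma toe_notin_L:
  assumes "a \<in> knees"
  shows "toe a \<notin> set L"
proof
  assume "toe a \<in> set L"
  then obtain j where j: "j < length L" "L ! j = toe a" by (metis in_set_conv_nth)
  have "j \<noteq> 0" using j L_0 toe(1)[OF assms] by metis
  have a: "{c, a} \<in> E" "a \<notin> set L"
    using stubs_or_knees_iff stubs_or_knees_notin_L assms by blast+
  have "a \<in> V" by (rule edgeD(2)[OF a(1)])
  have "graph_path V E (take (Suc j) L)" by (rule graph_path_take[OF L_path]) simp
  moreover have last: "last (take (Suc j) L) = toe a" using j by (simp add: take_Suc_conv_app_nth)
  ultimately have "graph_path V E (take (Suc j) L @ [a])"
    using a \<open>a \<in> V\<close> toe(2)[OF assms]
    by (intro graph_path_append1) (auto simp: insert_commute dest: in_set_takeD)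
  then have "graph_cycle V E (take (Suc j) L @ [a])"
    using j \<open>j \<noteq> 0\<close> a L_0 by (auto simp: graph_cycle_def hd_append hd_conv_nth insert_commute)
  then show False by (rule no_cycle)
qed

lemma toe_notin_stubs_or_knees:
  assumes "a \<in> knees"
  shows "toe a \<notin> stubs \<union> knees"
proof
  assume "toe a \<in> stubs \<union> knees"
  then have e: "{c, toe a} \<in> E" "{c, a} \<in> E" "{a, toe a} \<in> E" 
    using stubs_or_knees_iff toe assms by auto
  then have "graph_cycle V E [c, a, toe a]"
    using edgeD[OF e(1)] edgeD[OF e(2)] edgeD[OF e(3)]
    by (auto simp: graph_cycle_def graph_path_def less_Suc_eq insert_commute)
  then show False by (rule no_cycle)
qed

lemma inj_on_toe: "inj_on toe knees"
proof (rule inj_onI, rule ccontr)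
  fix a a' assume a: "a \<in> knees" "a' \<in> knees" "toe a = toe a'" "a \<noteq> a'"
  then have e: "{c, a} \<in> E" "{a, toe a} \<in> E" "{toe a, a'} \<in> E" "{a', c} \<in> E" "toe a \<noteq> c"
    using toe[OF a(1)] toe[OF a(2)] by (auto simp: knees_def insert_commute)
  then have "graph_cycle V E [c, a, toe a, a']"
    using a edgeD[OF e(1)] edgeD[OF e(2)] edgeD[OF e(3)] edgeD[OF e(4)]
    by (auto simp: graph_cycle_def graph_path_def less_Suc_eq insert_commute)
  then show False by (rule no_cycle)
qed

section \<open>Paths starting at the center\<close>

lemma at_most_two_neighbours:
  assumes "v \<noteq> c" "{v, x} \<in> E" "{v, y} \<in> E" "{v, z} \<in> E" "x \<noteq> y" "x \<noteq> z"
  shows "y = z"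
proof (rule ccontr)
  assume "y \<noteq> z"
  then have "card {x, y, z} = 3" using assms by simp
  moreover have "card {x, y, z} \<le> degree E v"
    using assms finite_E by (intro card_neighbours_le_degree) auto
  ultimately show False using degree_le_2[of v] edgeD(1)[OF assms(2)] assms(1) by simp
qed

text \<open>Away from \<open>c\<close> a vertex has at most two neighbours. The path has just used
  one of them, so its next vertex is forced to be that of \<open>L\<close>.\<close>

lemma path_along_long_leg:
  assumes p: "graph_path V E p" "p ! 0 = c" "p ! 1 = L ! 1" and "i < length p"
  shows "i < length L \<and> p ! i = L ! i"
  using assms(4)
proof (induction i rule: less_induct)
  case (less i)
  consider "i = 0" | "i = 1" | j where "i = Suc (Suc j)" by (metis One_nat_def not0_implies_Suc)
  then show ?case
  proof cases
    case 3
    have IH: "p ! j = L ! j" "Suc j < length L" "p ! Suc j = L ! Suc j"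
      using less 3 by auto
    have e: "{L ! Suc j, p ! i} \<in> E" "{L ! Suc j, L ! j} \<in> E"
      using graph_path_edge[OF p(1), of "Suc j"] graph_path_edge[OF p(1), of j] less.prems 3 IH
      by (auto simp: insert_commute)
    have ne: "L ! j \<noteq> p ! i"
      using p(1) less.prems 3 IH(1) nth_eq_iff_index_eq[of p j i] by (simp add: graph_path_def)
    have "i < length L"
    \<comment> \<open>Running beyond the end of \<open>L\<close> would give the leaf
      \<open>last L\<close> a second neighbour.\<close>
    proof (rule ccontr)
      assume "\<not> i < length L"
      then have "last L = L ! Suc j" using IH(2) 3 L_length
        by (subst last_conv_nth) (auto intro: arg_cong[of _ _ "nth L"])
      moreover have "card {L ! j, p ! i} \<le> degree E (L ! Suc j)"
        using e finite_E by (intro card_neighbours_le_degree) auto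
      ultimately show False using L_last ne by simp
    qed
    moreover have "L ! Suc j \<noteq> c"
      using nth_eq_iff_index_eq[OF L_distinct, of "Suc j" 0] IH(2) L_0 L_nonempty by simp
    moreover have "{L ! Suc j, L ! i} \<in> E" "L ! j \<noteq> L ! i"
      using graph_path_edge[OF L_path, of "Suc j"] L_distinct calculation(1) 3 IH(2)
      by (auto simp: nth_eq_iff_index_eq)
    ultimately show ?thesis
      using at_most_two_neighbours[OF _ e(2,1)] ne by blast
  qed (use p L_0 L_length in auto)
qed

text \<open>
  A path leaving the center off the long leg extends to a leg other than \<open>L\<close>, hence is short.
\<close>

lemma path_from_center_cases:
  assumes p: "graph_path V E p" "p ! 0 = c"
  obtains "length p \<le> length L" "p = take (length p) L"
  | a where "a \<in> stubs \<union> knees" "p = [c, a]"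
  | a where "a \<in> knees" "p = [c, a, toe a]"
proof -
  show ?thesis
  proof (cases "length p \<ge> 2 \<and> p ! 1 \<noteq> L ! 1")
    case False
    have *: "i < length L \<and> p ! i = L ! i" if "i < length p" for i
    proof (cases "length p \<ge> 2")
      case True
      then show ?thesis using path_along_long_leg[OF p _ that] False by blast
    next
      case False
      then have "i = 0" using that by simp
      then show ?thesis using p(2) L_0 L_nonempty by simp
    qed
    \<comment> \<open>If \<open>p\<close> were longer, the index \<open>length L\<close> would be
      valid for \<open>p\<close> and hence satisfy \<open>length L < length L\<close>.\<close>
    have "length p \<le> length L" using *[of "length L"] by (meson less_irrefl not_le)
    moreover from this have "p = take (length p) L" using * by (intro nth_equalityI) auto
    ultimately show ?thesis using that(1) by blast
  next
    case True
    then obtain a r where pa: "p = c # a # r"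
      using p(2) by (cases p; cases "tl p") auto
    have a: "{c, a} \<in> E" "a \<noteq> L ! 1"
      using graph_path_edge[OF p(1), of 0] True pa by auto
    have "length p \<le> 3"
    proof (rule ccontr)
      assume long: "\<not> length p \<le> 3"
      obtain q where q: "graph_path V E (p @ q)" "degree E (last (p @ q)) = 1"
        using graph_path_extends_to_leaf[OF simple acyclic p(1)] long by auto
      have "last (p @ q) \<noteq> c"
        using q(1) pa last_in_set[of "a # r @ q"] by (auto simp: graph_path_def)
      then have "p @ q \<in> spider_legs V E c"
        using q pa by (simp add: spider_legs_def)
      moreover have "p @ q \<noteq> L" using True pa by auto
      ultimately show False using short_leg[of "p @ q"] long by (simp add: path_length_def)
    qed
    then consider "r = []" | b where "r = [b]" using pa by (cases r) auto
    then show ?thesis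
    proof cases
      case 1
      then show ?thesis using that(2)[of a] pa a stubs_or_knees_iff by simp
    next
      case (2 b)
      then have b: "{a, b} \<in> E" "b \<noteq> c"
        using graph_path_edge[OF p(1), of 1] p(1) pa by (auto simp: graph_path_def)
      then have "a \<in> knees" using a by (auto simp: knees_def)
      \<comment> \<open>\<open>c\<close>, \<open>b\<close> and \<open>toe a\<close> are neighbours
        of \<open>a\<close>, which has at most two; so the choice made in \<open>toe\<close> is the
        only possible one.\<close>
      moreover have "b = toe a"
        using at_most_two_neighbours[of a c b "toe a"] toe[OF calculation] a b edgeD(3)[OF a(1)]
        by (auto simp: insert_commute)
      ultimately show ?thesis using that(3) pa 2 by blast
    qed
  qed
qed

lemma vertices_eq: "V = set L \<union> stubs \<union> knees \<union> toe ` knees"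
proof
  show "V \<subseteq> set L \<union> stubs \<union> knees \<union> toe ` knees"
  proof
    fix v assume "v \<in> V"
    then obtain p where p: "graph_path V E p" "hd p = c" "last p = v"
      using connected center_in by (auto simp: connected_graph_def)
    then have "p \<noteq> []" "p ! 0 = c" by (auto simp: graph_path_def hd_conv_nth)
    from path_from_center_cases[OF p(1) this(2)] show "v \<in> set L \<union> stubs \<union> knees \<union> toe ` knees"
    proof cases
      case 1
      then show ?thesis using p(3) \<open>p \<noteq> []\<close> by (metis Un_iff in_set_takeD last_in_set)
    qed (use p(3) in auto)
  qed
  show "set L \<union> stubs \<union> knees \<union> toe ` knees \<subseteq> V"
    using L_subset stubs_or_knees_iff edgeD(2) toe(2) by blast
qed

text \<open>Every edge \<open>{u, v}\<close> is the last edge of a path from \<open>c\<close>: take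
  a path to \<open>u\<close>; either \<open>v\<close> is its last but one vertex or the path can be
  prolonged to \<open>v\<close>. The possible paths from \<open>c\<close> are known.\<close>

lemma edges_subset:
  "E \<subseteq> (\<lambda>i. {L ! i, L ! Suc i}) ` {..<length L - 1} \<union> (\<lambda>a. {c, a}) ` (stubs \<union> knees) \<union>
     (\<lambda>a. {a, toe a}) ` knees" (is "_ \<subseteq> ?R")
proof
  have path_edge: "{p ! (length p - 2), last p} \<in> ?R"
    if p: "graph_path V E p" "p ! 0 = c" "length p \<ge> 2" for p
    using p(1,2)
  proof (cases rule: path_from_center_cases)
    case 1
    have nth: "p ! k = L ! k" if "k < length p" for k
      by (subst 1(2)) (simp add: that)
    have len: "p \<noteq> []" "length p - 1 < length p" "length p - 2 < length p"
      "length p - 1 = Suc (length p - 2)"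
      using p(3) by auto
    have "last p = L ! Suc (length p - 2)"
      using nth[OF len(2)] by (simp only: last_conv_nth[OF len(1)] len(4))
    moreover have "p ! (length p - 2) = L ! (length p - 2)"
      by (rule nth[OF len(3)])
    moreover have "length p - 2 < length L - 1" using 1(1) p(3) by linarith
    ultimately show ?thesis
      by (intro UnI1 image_eqI[where x = "length p - 2"]) (simp_all only: lessThan_iff)
  next
    case (2 a)
    then show ?thesis by simp
  next
    case (3 a)
    then show ?thesis by simp
  qed
  fix e assume "e \<in> E"
  then obtain u v where "u \<in> V \<and> v \<in> V \<and> u \<noteq> v \<and> e = {u, v}"
    using simple unfolding simple_graph_def by metis
  then have e: "e = {u, v}" "u \<in> V" "v \<in> V" "{u, v} \<in> E"
    using \<open>e \<in> E\<close> by auto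
  obtain p where p: "graph_path V E p" "hd p = c" "last p = u"
    using connected center_in e(2) by (auto simp: connected_graph_def)
  then have p0: "p \<noteq> []" "p ! 0 = c" by (auto simp: graph_path_def hd_conv_nth)
  show "e \<in> ?R"
  proof (cases "v \<in> set p")
    case True
    then have "length p \<ge> 2 \<and> v = p ! (length p - 2)"
      using chord_is_last_edge[OF simple acyclic p(1)] p(3) e(4) by simp
    then show ?thesis using path_edge[OF p(1) p0(2)] p(3) e(1) by (simp add: insert_commute)
  next
    case False
    then have "graph_path V E (p @ [v])"
      using graph_path_append1[OF p(1) e(3)] p(3) e(4) by simp
    from path_edge[OF this] show ?thesis
      using p0 p(3) e(1) by (simp add: nth_append last_conv_nth Suc_le_eq)
  qed
qed

section \<open>Counting vertices and edges\<close>

lemma stubs_knees_disjoint: "stubs \<inter> knees = {}"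
  by (auto simp: stubs_def)

lemma finite_stubs: "finite stubs" and finite_knees: "finite knees"
  using vertices_eq finite_V by (metis finite_Un)+

text \<open>An upper bound is enough here and for the edges: the labels and differences that occur
  give the lower bounds.\<close>

lemma card_vertices_le: "card V \<le> length L + card stubs + 2 * card knees"
proof -
  have "card V \<le> card (set L) + card stubs + card knees + card (toe ` knees)"
    unfolding vertices_eq
    by (rule order_trans[OF card_Un_le add_mono[OF order_trans[OF card_Un_le
          add_mono[OF card_Un_le order_refl]] order_refl]])
  moreover have "card (toe ` knees) \<le> card knees" by (rule card_image_le[OF finite_knees])
  ultimately show ?thesis using card_length[of L] by linarith
qed

lemma card_edges_le: "card E \<le> length L - 1 + card stubs + 2 * card knees"
proof -
  let ?A = "(\<lambda>i. {L ! i, L ! Suc i}) ` {..<length L - 1}" and ?B = "(\<lambda>a. {c, a}) ` (stubs \<union> knees)"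
    and ?C = "(\<lambda>a. {a, toe a}) ` knees"
  have "card E \<le> card (?A \<union> ?B \<union> ?C)"
    by (rule card_mono[OF _ edges_subset]) (simp add: finite_stubs finite_knees)
  also have "\<dots> \<le> card ?A + card ?B + card ?C"
    by (rule order_trans[OF card_Un_le add_mono[OF card_Un_le order_refl]])
  finally have "card E \<le> card ?A + card ?B + card ?C" .
  moreover have "card ?A \<le> length L - 1" using card_image_le[of "{..<length L - 1}"] by simp
  moreover have "card ?B \<le> card (stubs \<union> knees)" "card ?C \<le> card knees"
    by (simp_all add: card_image_le finite_stubs finite_knees)
  moreover have "card (stubs \<union> knees) \<le> card stubs + card knees" by (rule card_Un_le)
  ultimately show ?thesis by linarith
qed

section \<open>The labeling\<close>

text \<open>Turns labels prescribed by index into one function on vertices. The pieces are disjoint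
  and their enumerations injective, so the prescriptions do not conflict.\<close>

lemma labeling_exists:
  fixes x a b y :: "nat \<Rightarrow> int"
  obtains f h k where "bij_betw h {..<card knees} knees" "bij_betw k {..<card stubs} stubs"
    "\<And>i. i < length L \<Longrightarrow> f (L ! i) = x i"
    "\<And>i. i < card knees \<Longrightarrow> f (h i) = a i" "\<And>i. i < card knees \<Longrightarrow> f (toe (h i)) = b i"
    "\<And>i. i < card stubs \<Longrightarrow> f (k i) = y i"
proof -
  obtain h where h: "bij_betw h {..<card knees} knees"
    using ex_bij_betw_nat_finite[OF finite_knees] by (auto simp: atLeast0LessThan)
  obtain k where k: "bij_betw k {..<card stubs} stubs"
    using ex_bij_betw_nat_finite[OF finite_stubs] by (auto simp: atLeast0LessThan)
  have hk: "h i \<in> knees" if "i < card knees" for i using h that by (auto simp: bij_betw_def)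
  have kf: "k i \<in> stubs" if "i < card stubs" for i using k that by (auto simp: bij_betw_def)
  have inj: "inj_on h {..<card knees}" "inj_on k {..<card stubs}" "inj_on (nth L) {..<length L}"
    using h k L_distinct by (auto simp: bij_betw_def inj_on_nth)
  have inj_toe: "inj_on (\<lambda>i. toe (h i)) {..<card knees}"
    using comp_inj_on[OF inj(1), of toe] inj_on_toe h by (simp add: bij_betw_def comp_def)
  define f where "f v =
    (if v \<in> set L then x (inv_into {..<length L} (nth L) v)
     else if v \<in> stubs then y (inv_into {..<card stubs} k v)
     else if v \<in> knees then a (inv_into {..<card knees} h v)
     else b (inv_into {..<card knees} (\<lambda>i. toe (h i)) v))" for v
  show ?thesis
  proof (rule that[OF h k])
    show "f (L ! i) = x i" if "i < length L" for i
      using that inj(3) by (simp add: f_def inv_into_f_f)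
    show "f (h i) = a i" if "i < card knees" for i
      using that hk[OF that] inj(1) stubs_or_knees_notin_L[of "h i"] stubs_knees_disjoint
      by (auto simp: f_def inv_into_f_f)
    show "f (toe (h i)) = b i" if "i < card knees" for i
      using that hk[OF that] inv_into_f_f[OF inj_toe, of i] toe_notin_L toe_notin_stubs_or_knees
      by (auto simp: f_def)
    show "f (k i) = y i" if "i < card stubs" for i
      using that kf[OF that] inj(2) stubs_or_knees_notin_L[of "k i"]
      by (auto simp: f_def inv_into_f_f)
  qed
qed

lemma graceful_labeling_center_0: "\<exists>f. graceful_labeling V E f \<and> f c = 0"
proof -
  define l where "l = length L - 1"
  define m where "m = card knees"
  define q where "q = card stubs"
  \<comment> \<open>This will turn out to be the number of edges.\<close>
  define N where "N = l + 2 * m + q"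
  have len: "length L = Suc l" using L_nonempty by (simp add: l_def)
  obtain f h k where hk: "bij_betw h {..<m} knees" "bij_betw k {..<q} stubs"
    and fL: "\<And>i. i \<le> l \<Longrightarrow> f (L ! i) = leg_label l m i"
    and fh: "\<And>i. i < m \<Longrightarrow> f (h i) = 2 * int ((l + 2 * m) div 2 - i)"
    and ft: "\<And>i. i < m \<Longrightarrow> f (toe (h i)) = 2 * int i + 1"
    and fk: "\<And>i. i < q \<Longrightarrow> f (k i) = int (l + 2 * m) + 1 + int i"
    by (rule labeling_exists[of "leg_label l m" "\<lambda>i. 2 * int ((l + 2 * m) div 2 - i)"
          "\<lambda>i. 2 * int i + 1" "\<lambda>i. int (l + 2 * m) + 1 + int i",
          folded m_def q_def, unfolded len less_Suc_eq_le]) blast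
  have fc: "f c = 0" using fL[of 0] leg_label_simps(1)[of l m 0] L_0 by simp
  have h_in: "h i \<in> knees" if "i < m" for i using hk(1) that by (auto simp: bij_betw_def)
  have k_in: "k i \<in> stubs" if "i < q" for i using hk(2) that by (auto simp: bij_betw_def)
  \<comment> \<open>Used for labels and for differences alike: since \<open>f c = 0\<close>, the
    edge from \<open>c\<close> to \<open>k i\<close> has difference \<open>f (k i)\<close>.\<close>
  have leaf: "\<exists>i<q. d = f (k i)" if "int (l + 2 * m) < d" "d \<le> int N" for d
  proof -
    define i where "i = nat (d - int (l + 2 * m) - 1)"
    have "i < q" "d = int (l + 2 * m) + 1 + int i" using that by (auto simp: i_def N_def)
    then show ?thesis using fk by metis
  qed
  have "{0..int N} \<subseteq> f ` V"
  proof
    fix v assume v: "v \<in> {0..int N}"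
    show "v \<in> f ` V"
    proof (cases "v \<le> int (l + 2 * m)")
      case True
      consider t where "t \<le> l" "v = leg_label l m t"
        | i where "i < m" "v = 2 * int ((l + 2 * m) div 2 - i)" | i where "i < m" "v = 2 * int i + 1"
        using labels_surjective[of v l m] True v by auto
      then show ?thesis
      proof cases
        case (1 t)
        then have "L ! t \<in> V" using L_subset len by auto
        then show ?thesis using fL[OF 1(1)] 1(2) by (metis imageI)
      next
        case (2 i)
        then have "h i \<in> V" using vertices_eq h_in by auto
        then show ?thesis using fh[OF 2(1)] 2(2) by (metis imageI)
      next
        case (3 i)
        then have "toe (h i) \<in> V" using vertices_eq h_in by auto
        then show ?thesis using ft[OF 3(1)] 3(2) by (metis imageI)
      qed
    next
      case False
      then obtain i where "i < q" "v = f (k i)"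
        using leaf[of v] v by (meson atLeastAtMost_iff not_le)
      moreover have "k i \<in> V" using vertices_eq k_in calculation by auto
      ultimately show ?thesis by blast
    qed
  qed
  \<comment> \<open>The image of \<open>V\<close> has at least \<open>N + 1\<close> elements and
    \<open>V\<close> at most that many, so \<open>f\<close> is injective and takes no further
    values.\<close>
  moreover have "card V \<le> N + 1"
    using card_vertices_le len by (simp add: N_def m_def q_def)
  moreover have "card {0..int N} = N + 1" by simp
  moreover have "card (f ` V) \<le> card V" by (rule card_image_le[OF finite_V])
  moreover have "card {0..int N} \<le> card (f ` V)"
    using calculation(1) finite_V by (intro card_mono) auto
  ultimately have inj: "inj_on f V" and image: "f ` V = {0..int N}"
    using eq_card_imp_inj_on[OF finite_V, of f] card_seteq[of "f ` V" "{0..int N}"] finite_V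
    by simp_all
  let ?D = "{\<bar>f x - f y\<bar> |x y. {x, y} \<in> E}"
  have diff: "\<bar>f x - f y\<bar> \<in> ?D" if "{x, y} \<in> E" for x y using that by blast
  have sub: "{1..int N} \<subseteq> ?D"
  proof
    fix d assume d: "d \<in> {1..int N}"
    show "d \<in> ?D"
    proof (cases "d \<le> int (l + 2 * m)")
      case True
      consider t where "t < l" "d = \<bar>leg_label l m t - leg_label l m (Suc t)\<bar>"
        | i where "i < m" "d = 2 * int ((l + 2 * m) div 2 - i)"
        | i where "i < m" "d = \<bar>2 * int ((l + 2 * m) div 2 - i) - (2 * int i + 1)\<bar>"
        using differences_surjective[of d l m] True d by auto
      then show ?thesis
      proof cases
        case (1 t)
        then have "{L ! t, L ! Suc t} \<in> E" using graph_path_edge[OF L_path] len by simp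
        from diff[OF this] show ?thesis using fL[of t] fL[of "Suc t"] 1 by simp
      next
        case (2 i)
        then have "{c, h i} \<in> E" using stubs_or_knees_iff h_in by blast
        from diff[OF this] show ?thesis using fh[OF 2(1)] 2(2) fc by simp
      next
        case (3 i)
        then have "{h i, toe (h i)} \<in> E" using toe(2) h_in by blast
        from diff[OF this] show ?thesis using fh[OF 3(1)] ft[OF 3(1)] 3(2) by simp
      qed
    next
      case False
      then obtain i where i: "i < q" "d = f (k i)"
        using leaf[of d] d by (meson atLeastAtMost_iff not_le)
      then have "{c, k i} \<in> E" using stubs_or_knees_iff k_in by blast
      from diff[OF this] show ?thesis using i d fc by simp
    qed
  qed
  \<comment> \<open>\<open>\<delta> {x, y} = |f x - f y|\<close>, but as a function of the edge, so that \<open>card ?D \<le> card E\<close>\<close>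
  define \<delta> where "\<delta> e = Max (f ` e) - Min (f ` e)" for e
  have "\<bar>f x - f y\<bar> = \<delta> {x, y}" for x y by (simp add: \<delta>_def)
  then have D: "?D \<subseteq> \<delta> ` E" by auto
  then have fin_D: "finite ?D" using finite_E by (rule finite_surj[rotated])
  \<comment> \<open>The same squeeze for edges: \<open>N \<le> card ?D \<le> card E \<le> N\<close>,
    so no difference outside \<open>{1..int N}\<close> occurs.\<close>
  have "card ?D \<le> card E"
    using card_mono[OF _ D] card_image_le[OF finite_E, of \<delta>] finite_E by simp
  moreover have "card E \<le> N" using card_edges_le by (simp add: N_def l_def m_def q_def)
  moreover have "N \<le> card ?D" using card_mono[OF fin_D sub] by simp
  ultimately have "card E = N" "?D = {1..int N}"
    using card_seteq[OF fin_D sub] by simp_all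
  then have "graceful_labeling V E f"
    using inj image unfolding graceful_labeling_def by simp
  then show ?thesis using fc by blast
qed

end

theorem theorem1p5:
  fixes V :: "'a set" and E :: "'a set set" and c :: 'a
  assumes "spider V E"
    and "spider_center V E c"
    and "\<exists>L \<in> spider_legs V E c. \<forall>L' \<in> spider_legs V E c. L' \<noteq> L \<longrightarrow> path_length L' \<le> 2"
  shows "\<exists>f. graceful_labeling V E f \<and> f c = 0"
proof -
  obtain L where L: "L \<in> spider_legs V E c"
    "\<And>L'. L' \<in> spider_legs V E c \<Longrightarrow> L' \<noteq> L \<Longrightarrow> path_length L' \<le> 2"
    using assms(3) by blast
  have c: "c \<in> V" using assms(2) by (simp add: spider_center_def)
  have tree: "simple_graph V E" "connected_graph V E" "\<not> (\<exists>p. graph_cycle V E p)"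
    using assms(1) by (simp_all add: spider_def tree_graph_def)
  \<comment> \<open>A vertex of degree above two forces the center to have such a degree too, and a
    spider has at most one such vertex.\<close>
  have "degree E v \<le> 2" if "v \<in> V" "v \<noteq> c" for v
  proof (rule ccontr)
    assume "\<not> degree E v \<le> 2"
    then have "degree E v > 2" by simp
    moreover from this have "degree E c > 2"
      using assms(2) that(1) by (auto simp: spider_center_def)
    ultimately show False using assms(1) that c by (auto simp: spider_def)
  qed
  then interpret long_leg_spider V E c L
    using tree c L by unfold_locales auto
  show ?thesis by (rule graceful_labeling_center_0)
qed

end
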